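(* Let $r\ge1$ and let $m_0,\dots,m_r\ge1$, $k_1,\dots,k_r\ge0$ be integers such that (1) $m_0,m_r\ge2$; (2) $k_i\ge m_{i-1}+m_i+3$ for $2\le i\le r-1$; (3) $k_j\ge m_{j-1}+m_j+1$ for $j\in\{1,r\}$. Then the open quipu $P_{(m_0,k_1,\dots,k_r,m_r)}^{(m_0,\dots,m_r)}$ has spectral radius less than $\frac{3}{2}\sqrt2$.
   Context: Spectral radius means the largest adjacency eigenvalue. A pendant path of length $\ell$ at $v$ means new vertices $u_1,\dots,u_\ell$ and the path $vu_1\cdots u_\ell$. The tree $P_{(m_0,k_1,\dots,k_r,m_r)}^{(m_0,\dots,m_r)}$ is obtained from vertices $v_0,\dots,v_r$ by joining $v_{i-1}$ and $v_i$ ($1\le i\le r$) by a path with $k_i$ internal vertices, attaching at $v_0$ two pendant paths each of length $m_0$, at $v_r$ two pendant paths each of length $m_r$, and at each $v_i$ ($1\le i\le r-1$) one pendant path of length $m_i$. *)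

theory Defs
  imports "Graph_Theory.Graph_Theory" "Jordan_Normal_Form.Spectral_Radius"
begin

text \<open>A simple graph is a \<^locale>\<open>pair_graph\<close>: each undirected edge is a pair of opposite arcs.
  The spectrum of an adjacency matrix does not depend on how the vertices are enumerated.\<close>

definition vertex_enum :: "'a pair_pre_digraph \<Rightarrow> 'a list" where
  "vertex_enum G = (SOME vs. distinct vs \<and> set vs = pverts G)"

definition adjacency_matrix :: "'a pair_pre_digraph \<Rightarrow> real mat" where
  "adjacency_matrix G =
     mat (card (pverts G)) (card (pverts G))
       (\<lambda>(i, j). if (vertex_enum G ! i, vertex_enum G ! j) \<in> parcs G then 1 else 0)"

definition graph_spectral_radius :: "'a pair_pre_digraph \<Rightarrow> real" where
  "graph_spectral_radius G = Max (spectrum (adjacency_matrix G))"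

text \<open>\<open>Node i\<close> is $v_i$; \<open>Inner i l\<close> is the $l$-th internal vertex (from 1) of the path joining
  $v_{i-1}$ and $v_i$; \<open>Pendant i c l\<close> is the $l$-th new vertex (from 1) of the $c$-th pendant path
  (from 0) at $v_i$.\<close>

datatype quipu_vertex = Node nat | Inner nat nat | Pendant nat nat nat

definition joining_path :: "(nat \<Rightarrow> nat) \<Rightarrow> nat \<Rightarrow> quipu_vertex list" where
  "joining_path k i = Node (i - 1) # map (Inner i) [1..<k i + 1] @ [Node i]"

definition pendant_path :: "(nat \<Rightarrow> nat) \<Rightarrow> nat \<Rightarrow> nat \<Rightarrow> quipu_vertex list" where
  "pendant_path m i c = Node i # map (Pendant i c) [1..<m i + 1]"

definition num_pendant :: "nat \<Rightarrow> nat \<Rightarrow> nat" where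
  "num_pendant r i = (if i = 0 \<or> i = r then 2 else 1)"

definition quipu_paths :: "nat \<Rightarrow> (nat \<Rightarrow> nat) \<Rightarrow> (nat \<Rightarrow> nat) \<Rightarrow> quipu_vertex list set" where
  "quipu_paths r m k =
     {joining_path k i | i. 1 \<le> i \<and> i \<le> r} \<union>
     {pendant_path m i c | i c. i \<le> r \<and> c < num_pendant r i}"

definition path_arcs :: "'a list \<Rightarrow> 'a rel" where
  "path_arcs xs = set (zip xs (tl xs))"

text \<open>Only \<open>m 0, \<dots>, m r\<close> and \<open>k 1, \<dots>, k r\<close> are used.\<close>

definition open_quipu ::
    "nat \<Rightarrow> (nat \<Rightarrow> nat) \<Rightarrow> (nat \<Rightarrow> nat) \<Rightarrow> quipu_vertex pair_pre_digraph" where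
  "open_quipu r m k =
     \<lparr> pverts = (\<Union>xs \<in> quipu_paths r m k. set xs),
       parcs = (\<Union>xs \<in> quipu_paths r m k. path_arcs xs \<union> (path_arcs xs)\<inverse>) \<rparr>"

lemma finite_quipu_paths: "finite (quipu_paths r m k)"
proof -
  have "quipu_paths r m k \<subseteq>
      joining_path k ` {1..r} \<union> (\<lambda>(i, c). pendant_path m i c) ` ({..r} \<times> {..<2})"
    by (force simp: quipu_paths_def num_pendant_def split: if_splits)
  then show ?thesis
    by (rule finite_subset) simp
qed

lemma path_arcs_subset: "path_arcs xs \<subseteq> set xs \<times> set xs"
  unfolding path_arcs_def
  by (cases xs) (auto dest: set_zip_leftD set_zip_rightD)

lemma path_arcs_irrefl: "distinct xs \<Longrightarrow> (x, x) \<notin> path_arcs xs"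
  unfolding path_arcs_def
  by (auto simp: in_set_zip nth_tl distinct_conv_nth)

lemma distinct_quipu_paths: "xs \<in> quipu_paths r m k \<Longrightarrow> distinct xs"
  by (auto simp: quipu_paths_def joining_path_def pendant_path_def distinct_map inj_on_def)

lemma pair_graph_open_quipu: "pair_graph (open_quipu r m k)"
proof
  show "fst e \<in> pverts (open_quipu r m k)" "snd e \<in> pverts (open_quipu r m k)"
    if "e \<in> parcs (open_quipu r m k)" for e
    using that path_arcs_subset by (fastforce simp: open_quipu_def)+
  show "fst e \<noteq> snd e" if "e \<in> parcs (open_quipu r m k)" for e
    using that path_arcs_irrefl[OF distinct_quipu_paths]
    by (cases e) (auto simp: open_quipu_def)
  show "finite (pverts (open_quipu r m k))" "finite (parcs (open_quipu r m k))"
    by (auto simp: open_quipu_def finite_quipu_paths path_arcs_def)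
  show "symmetric (open_quipu r m k)"
    by (auto simp: symmetric_def open_quipu_def intro!: symI)
qed

end

theory Submission
  imports Defs
begin

text \<open>Let $\lambda = \frac32\sqrt2 = t + 1/t$ with $t = \sqrt2$. Give every arc $uv$ a weight
  $q_{uv} > 0$ with $q_{uv} q_{vu} = 1$; if the weights leaving each vertex sum to at most
  $\lambda$, then AM-GM applied to the quadratic form of the adjacency matrix bounds every
  eigenvalue by $\lambda$. On a path the weights are quotients of consecutive values of a solution
  of $x_{j-1} + x_{j+1} = \lambda x_j$, that is, of $t^j + B t^{-j}$. The pendant paths at $v_i$
  leave room for solutions that decrease along the adjacent joining paths up to a distance which is
  below $m_i$ for $i \in \{0, r\}$ and below $m_i + 2$ otherwise; the hypotheses on the $k_i$ say that
  on each joining path both solutions pass their minimum before they meet. Finally $\lambda$ itself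
  is not an eigenvalue, because $\lambda^2 = 9/2$ would be a rational algebraic integer.\<close>

section \<open>Eigenvalues of real symmetric matrices and of integer matrices\<close>

lemma eigenvalue_entries:
  assumes A: "A \<in> carrier_mat n n" and ev: "eigenvalue A c"
  obtains v where "v \<in> carrier_vec n" "\<exists>i<n. v $ i \<noteq> 0"
    "\<And>i. i < n \<Longrightarrow> (\<Sum>j<n. A $$ (i, j) * v $ j) = c * v $ i"
proof -
  obtain v where v: "v \<in> carrier_vec n" "v \<noteq> 0\<^sub>v n" "A *\<^sub>v v = c \<cdot>\<^sub>v v"
    using ev A unfolding eigenvalue_def eigenvector_def by auto
  have "\<exists>i<n. v $ i \<noteq> 0"
    using v(1,2) by (metis carrier_vecD eq_vecI index_zero_vec)
  moreover have "(\<Sum>j<n. A $$ (i, j) * v $ j) = c * v $ i" if "i < n" for i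
  proof -
    have "(\<Sum>j<n. A $$ (i, j) * v $ j) = (A *\<^sub>v v) $ i"
      using A v(1) that by (auto simp: scalar_prod_def atLeast0LessThan intro!: sum.cong)
    then show ?thesis
      using v that by simp
  qed
  ultimately show ?thesis
    using that v(1) by blast
qed

text \<open>A complex eigenvalue \<open>c\<close> with eigenvector \<open>v\<close> always exists.
  By symmetry the form \<open>s\<close> (conjugate of \<open>v\<close>, times \<open>A\<close>,
  times \<open>v\<close>) is its own conjugate, and \<open>s\<close> is \<open>c\<close> times the
  positive number \<open>N\<close>, so \<open>c\<close> is real. The characteristic polynomial
  commutes with the embedding of the reals, so \<open>c\<close> is already an eigenvalue of
  \<open>A\<close>. This is needed because \<open>Max\<close> of an empty spectrum would be
  unspecified.\<close>

lemma spectrum_symmetric_real_nonempty: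
  fixes A :: "real mat"
  assumes A: "A \<in> carrier_mat n n" and n: "n > 0"
    and sym: "\<And>i j. i < n \<Longrightarrow> j < n \<Longrightarrow> A $$ (i, j) = A $$ (j, i)"
  shows "spectrum A \<noteq> {}"
proof -
  define B where "B = map_mat complex_of_real A"
  have B: "B \<in> carrier_mat n n"
    using A by (simp add: B_def)
  obtain c where c: "eigenvalue B c"
    using spectrum_non_empty[OF B n] by (auto simp: spectrum_def)
  obtain v where v: "\<exists>i<n. v $ i \<noteq> 0"
    "\<And>i. i < n \<Longrightarrow> (\<Sum>j<n. B $$ (i, j) * v $ j) = c * v $ i"
    using eigenvalue_entries[OF B c] by metis
  define N where "N = (\<Sum>i<n. (cmod (v $ i))\<^sup>2)"
  have "N > 0"
    using v(1) unfolding N_def by (auto intro!: sum_pos2)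
  define s where "s = (\<Sum>i<n. \<Sum>j<n. cnj (v $ i) * (of_real (A $$ (i, j)) * v $ j))"
  have "(\<Sum>j<n. of_real (A $$ (i, j)) * v $ j) = c * v $ i" if "i < n" for i
    using A v(2)[OF that] that by (simp add: B_def)
  then have "s = (\<Sum>i<n. cnj (v $ i) * (c * v $ i))"
    by (simp add: s_def flip: sum_distrib_left)
  also have "\<dots> = c * of_real N"
    by (simp add: N_def sum_distrib_left complex_norm_square mult_ac del: of_real_power)
  finally have s: "s = c * of_real N" .
  have "cnj s = (\<Sum>i<n. \<Sum>j<n. v $ i * (of_real (A $$ (i, j)) * cnj (v $ j)))"
    by (simp add: s_def cnj_sum)
  also have "\<dots> = (\<Sum>j<n. \<Sum>i<n. v $ i * (of_real (A $$ (i, j)) * cnj (v $ j)))"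
    by (rule sum.swap)
  also have "\<dots> = s"
    unfolding s_def by (intro sum.cong) (simp_all add: sym)
  finally have "cnj s = s" .
  then have "cnj c = c"
    using s \<open>N > 0\<close> by simp
  then obtain x where x: "c = of_real x"
    by (metis Reals_cnj_iff Reals_cases)
  have "of_real (poly (char_poly A) x) = poly (char_poly B) c"
    by (simp add: B_def x of_real_hom.char_poly_hom[OF A])
  also have "\<dots> = 0"
    using c eigenvalue_root_char_poly[OF B] by simp
  finally show ?thesis
    by (auto simp: spectrum_root_char_poly[OF A])
qed

text \<open>The number \<open>c\<^sup>2\<close> is an eigenvalue of the integer matrix
  \<open>A * A\<close>, hence a root of a monic integer polynomial, and a rational algebraic integer
  is an integer. Passing to the square brings the irrational candidate \<open>3 / 2 * sqrt 2\<close>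
  within reach of this argument.\<close>

lemma eigenvalue_int_mat_square_Ints:
  fixes A :: "int mat" and c :: real
  assumes A: "A \<in> carrier_mat n n" and ev: "eigenvalue (map_mat of_int A) c"
    and rat: "c\<^sup>2 \<in> \<rat>"
  shows "c\<^sup>2 \<in> \<int>"
proof -
  let ?R = "map_mat real_of_int A"
  have R: "?R \<in> carrier_mat n n"
    using A by simp
  obtain v where v: "v \<in> carrier_vec n" "v \<noteq> 0\<^sub>v n" "?R *\<^sub>v v = c \<cdot>\<^sub>v v"
    using ev R unfolding eigenvalue_def eigenvector_def by auto
  have "(?R * ?R) *\<^sub>v v = c\<^sup>2 \<cdot>\<^sub>v v"
    using v R by (simp add: assoc_mult_mat_vec[OF R R] mult_mat_vec[OF R] smult_smult_assoc power2_eq_square)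
  then have "eigenvalue (?R * ?R) (c\<^sup>2)"
    using v R unfolding eigenvalue_def eigenvector_def by auto
  moreover have "?R * ?R = map_mat real_of_int (A * A)"
    by (rule of_int_hom.mat_hom_mult[OF A A, symmetric])
  ultimately have "eigenvalue (map_mat real_of_int (A * A)) (c\<^sup>2)"
    by simp
  moreover have AA: "A * A \<in> carrier_mat n n"
    using A by simp
  ultimately have "poly (char_poly (map_mat real_of_int (A * A))) (c\<^sup>2) = 0"
    using eigenvalue_root_char_poly[of "map_mat real_of_int (A * A)" n] by simp
  then have "poly (of_int_poly (char_poly (A * A))) (c\<^sup>2) = 0"
    by (simp only: of_int_hom.char_poly_hom[OF AA])
  moreover have "lead_coeff (char_poly (A * A)) = 1"
    using degree_monic_char_poly[OF AA] by auto
  ultimately have "algebraic_int (c\<^sup>2)"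
    by (auto simp: algebraic_int_altdef_ipoly)
  then show ?thesis
    using rat by (rule rational_algebraic_int_is_int)
qed

section \<open>Adjacency matrices and their eigenvalues\<close>

lemma vertex_enum:
  assumes "finite (pverts G)"
  shows "distinct (vertex_enum G)" "set (vertex_enum G) = pverts G"
proof -
  have "\<exists>vs. distinct vs \<and> set vs = pverts G"
    using finite_distinct_list[OF assms] by blast
  then have "distinct (vertex_enum G) \<and> set (vertex_enum G) = pverts G"
    unfolding vertex_enum_def by (rule someI_ex)
  then show "distinct (vertex_enum G)" "set (vertex_enum G) = pverts G"
    by auto
qed

lemma bij_betw_vertex_enum:
  assumes "finite (pverts G)"
  shows "bij_betw ((!) (vertex_enum G)) {..<card (pverts G)} (pverts G)"
proof -
  have "card (pverts G) = length (vertex_enum G)"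
    using vertex_enum[OF assms] by (metis distinct_card)
  then show ?thesis
    using vertex_enum[OF assms] by (auto intro: bij_betw_nth)
qed

lemma adjacency_matrix_carrier:
  "adjacency_matrix G \<in> carrier_mat (card (pverts G)) (card (pverts G))"
  by (simp add: adjacency_matrix_def)

lemma graph_spectral_radius_eigenvalue:
  assumes "pair_graph G" and "pverts G \<noteq> {}"
  shows "eigenvalue (adjacency_matrix G) (graph_spectral_radius G)"
proof -
  interpret pair_graph G by fact
  have "(u, v) \<in> parcs G \<longleftrightarrow> (v, u) \<in> parcs G" for u v
    using arcs_symmetric by blast
  then have "spectrum (adjacency_matrix G) \<noteq> {}"
    using assms(2)
    by (intro spectrum_symmetric_real_nonempty[OF adjacency_matrix_carrier])
      (auto simp: adjacency_matrix_def card_gt_0_iff)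
  then have "graph_spectral_radius G \<in> spectrum (adjacency_matrix G)"
    unfolding graph_spectral_radius_def
    using card_finite_spectrum(1)[OF adjacency_matrix_carrier] by (intro Max_in)
  then show ?thesis
    by (simp add: spectrum_def)
qed

lemma adjacency_eigenvalue_square_Ints:
  assumes "eigenvalue (adjacency_matrix G) c" and "c\<^sup>2 \<in> \<rat>"
  shows "c\<^sup>2 \<in> \<int>"
proof -
  define A :: "int mat" where "A = mat (card (pverts G)) (card (pverts G))
       (\<lambda>(i, j). if (vertex_enum G ! i, vertex_enum G ! j) \<in> parcs G then 1 else 0)"
  have "map_mat real_of_int A = adjacency_matrix G"
    by (auto simp: A_def adjacency_matrix_def intro!: eq_matI)
  then show ?thesis
    using eigenvalue_int_mat_square_Ints[of A "card (pverts G)" c] assms by (simp add: A_def)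
qed

text \<open>Transporting an eigenvector along the bijection given by \<open>vertex_enum\<close>
  turns it into a function on vertices. From here on no enumeration of the vertices appears.\<close>

lemma adjacency_eigenfunction:
  assumes "pair_graph G" and ev: "eigenvalue (adjacency_matrix G) c"
  obtains z where "\<exists>u\<in>pverts G. z u \<noteq> 0"
    "\<And>u. u \<in> pverts G \<Longrightarrow> (\<Sum>v | (u, v) \<in> parcs G. z v) = c * z u"
proof -
  interpret pair_graph G by fact
  let ?n = "card (pverts G)" and ?e = "(!) (vertex_enum G)"
  obtain x where x: "\<exists>i<?n. x $ i \<noteq> 0"
    "\<And>i. i < ?n \<Longrightarrow> (\<Sum>j<?n. adjacency_matrix G $$ (i, j) * x $ j) = c * x $ i"
    using eigenvalue_entries[OF adjacency_matrix_carrier ev] by metis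
  have bij: "bij_betw ?e {..<?n} (pverts G)"
    by (rule bij_betw_vertex_enum) simp
  define z where "z u = x $ (inv_into {..<?n} ?e u)" for u
  have z: "z (?e i) = x $ i" if "i < ?n" for i
    using bij that by (simp add: z_def bij_betw_def inv_into_f_f)
  have "\<exists>u\<in>pverts G. z u \<noteq> 0"
    using x(1) z bij by (metis bij_betwE lessThan_iff)
  moreover have "(\<Sum>v | (u, v) \<in> parcs G. z v) = c * z u" if "u \<in> pverts G" for u
  proof -
    have "u \<in> ?e ` {..<?n}"
      using that bij_betw_imp_surj_on[OF bij] by simp
    then obtain i where i: "i < ?n" "u = ?e i"
      by auto
    have "(\<Sum>v | (u, v) \<in> parcs G. z v) = (\<Sum>v\<in>pverts G. if (u, v) \<in> parcs G then z v else 0)"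
      by (intro sum.mono_neutral_cong_left) (auto dest: wellformed)
    also have "\<dots> = (\<Sum>j<?n. if (u, ?e j) \<in> parcs G then z (?e j) else 0)"
      by (rule sum.reindex_bij_betw[OF bij, symmetric])
    also have "\<dots> = (\<Sum>j<?n. adjacency_matrix G $$ (i, j) * x $ j)"
      using i by (intro sum.cong) (auto simp: adjacency_matrix_def z)
    finally show ?thesis
      using x(2) i z by simp
  qed
  ultimately show ?thesis
    using that by blast
qed

section \<open>An upper bound for eigenvalues from arc weights\<close>

text \<open>The weights split every edge term by AM-GM:
  $2 z_u z_v \le q_{uv} z_u^2 + q_{vu} z_v^2$ whenever $q_{uv} q_{vu} = 1$.\<close>

lemma eigenvalue_le_arc_weights:
  fixes q :: "'a \<Rightarrow> 'a \<Rightarrow> real"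
  assumes "pair_graph G" and ev: "eigenvalue (adjacency_matrix G) c"
    and pos: "\<And>u v. (u, v) \<in> parcs G \<Longrightarrow> q u v > 0"
    and inv: "\<And>u v. (u, v) \<in> parcs G \<Longrightarrow> q u v * q v u = 1"
    and bound: "\<And>u. u \<in> pverts G \<Longrightarrow> (\<Sum>v | (u, v) \<in> parcs G. q u v) \<le> b"
  shows "c \<le> b"
proof -
  interpret pair_graph G by fact
  obtain z where z: "\<exists>u\<in>pverts G. z u \<noteq> 0"
    "\<And>u. u \<in> pverts G \<Longrightarrow> (\<Sum>v | (u, v) \<in> parcs G. z v) = c * z u"
    using adjacency_eigenfunction[OF \<open>pair_graph G\<close> ev] by metis
  have arcs: "parcs G = Sigma (pverts G) (\<lambda>u. {v. (u, v) \<in> parcs G})"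
    by (auto dest: wellformed)
  have fin: "finite {v. (u, v) \<in> parcs G}" for u
    by (rule finite_subset[of _ "pverts G"]) (auto dest: wellformed)
  have nested: "(\<Sum>u\<in>pverts G. \<Sum>v | (u, v) \<in> parcs G. f u v) = (\<Sum>(u, v)\<in>parcs G. f u v)"
    for f :: "'a \<Rightarrow> 'a \<Rightarrow> real"
    using sum.Sigma[of "pverts G" "\<lambda>u. {v. (u, v) \<in> parcs G}" f] fin
    by (simp add: arcs[symmetric])
  have sym: "(u, v) \<in> parcs G \<longleftrightarrow> (v, u) \<in> parcs G" for u v
    using arcs_symmetric by blast
  \<comment> \<open>Reversing arcs permutes \<open>parcs G\<close>, so the two halves of the AM-GM
    bound have equal sums and the factor 1/2 disappears.\<close>
  have swap: "(\<Sum>(u, v)\<in>parcs G. q v u * (z v)\<^sup>2) = (\<Sum>(u, v)\<in>parcs G. q u v * (z u)\<^sup>2)"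
    by (rule sum.reindex_bij_witness[of _ prod.swap prod.swap]) (auto simp: sym)
  have am_gm: "z u * z v \<le> (q u v * (z u)\<^sup>2 + q v u * (z v)\<^sup>2) / 2" if "(u, v) \<in> parcs G" for u v
  proof -
    have "0 \<le> (q u v * z u - z v)\<^sup>2 / q u v"
      using pos[OF that] by simp
    also have "\<dots> = q u v * (z u)\<^sup>2 + (z v)\<^sup>2 / q u v - 2 * (z u * z v)"
      using pos[OF that] by (simp add: field_simps power2_eq_square)
    also have "(z v)\<^sup>2 / q u v = q v u * (z v)\<^sup>2"
      using inv[OF that] pos[OF that] by (simp add: field_simps)
    finally show ?thesis
      by simp
  qed
  have "c * (\<Sum>u\<in>pverts G. (z u)\<^sup>2) = (\<Sum>u\<in>pverts G. \<Sum>v | (u, v) \<in> parcs G. z u * z v)"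
    by (simp add: sum_distrib_left[symmetric] z(2)) (simp add: sum_distrib_left power2_eq_square mult_ac)
  also have "\<dots> = (\<Sum>(u, v)\<in>parcs G. z u * z v)"
    by (rule nested)
  also have "\<dots> \<le> (\<Sum>(u, v)\<in>parcs G. (q u v * (z u)\<^sup>2 + q v u * (z v)\<^sup>2) / 2)"
    by (rule sum_mono) (auto intro: am_gm)
  also have "\<dots> = ((\<Sum>(u, v)\<in>parcs G. q u v * (z u)\<^sup>2) + (\<Sum>(u, v)\<in>parcs G. q v u * (z v)\<^sup>2)) / 2"
    by (simp add: sum.distrib sum_divide_distrib add_divide_distrib case_prod_unfold)
  also have "\<dots> = (\<Sum>(u, v)\<in>parcs G. q u v * (z u)\<^sup>2)"
    unfolding swap by simp
  also have "\<dots> = (\<Sum>u\<in>pverts G. (\<Sum>v | (u, v) \<in> parcs G. q u v) * (z u)\<^sup>2)"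
    by (simp add: sum_distrib_right nested)
  also have "\<dots> \<le> (\<Sum>u\<in>pverts G. b * (z u)\<^sup>2)"
    by (intro sum_mono mult_right_mono bound) auto
  finally have "c * (\<Sum>u\<in>pverts G. (z u)\<^sup>2) \<le> b * (\<Sum>u\<in>pverts G. (z u)\<^sup>2)"
    by (simp add: sum_distrib_left)
  moreover have "(\<Sum>u\<in>pverts G. (z u)\<^sup>2) > 0"
    using z(1) by (auto intro!: sum_pos2)
  ultimately show ?thesis
    by simp
qed

section \<open>Positive solutions of the path recurrence\<close>

text \<open>Up to scaling, the positive solutions of $x_{j-1} + x_{j+1} = \lambda x_j$ for
  $\lambda = \frac32\sqrt2 = \sqrt2 + 1/\sqrt2$ that we need; the minimum lies where $2^j = B$.
  The solution with \<open>B = -1\<close> vanishes at 0 and, read backwards, fits a pendant path.\<close>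

definition path_solution :: "real \<Rightarrow> nat \<Rightarrow> real" where
  "path_solution B j = sqrt 2 ^ j + B / sqrt 2 ^ j"

lemma path_solution_pos: "B \<ge> 0 \<Longrightarrow> path_solution B j > 0"
  by (simp add: path_solution_def add_pos_nonneg)

lemma path_solution_neg_one_pos:
  assumes "j > 0"
  shows "path_solution (-1) j > 0"
proof -
  have "sqrt 2 ^ j > 1"
    using assms by (intro one_less_power) auto
  moreover from this have "1 / sqrt 2 ^ j < 1"
    by simp
  ultimately have "1 / sqrt 2 ^ j < sqrt 2 ^ j"
    by linarith
  then show ?thesis
    by (simp add: path_solution_def)
qed

lemma path_solution_recurrence:
  "path_solution B j + path_solution B (j + 2) = 3 / 2 * sqrt 2 * path_solution B (j + 1)"
proof -
  define x where "x = sqrt 2 ^ j"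
  have "x > 0"
    by (simp add: x_def)
  have "sqrt 2 ^ (j + 1) = sqrt 2 * x" "sqrt 2 ^ (j + 2) = 2 * x"
    by (simp_all add: x_def power_add)
  then show ?thesis
    using \<open>x > 0\<close> by (simp add: path_solution_def x_def[symmetric] field_simps)
qed

text \<open>With \<open>x = sqrt 2 ^ j\<close> and \<open>y = B / x\<close> the claim reads
  \<open>x + y\<close> \<le> \<open>3/2 * x + 3/4 * y\<close>, that is \<open>y\<close> \<le>
  \<open>2 * x\<close>, which is the assumption on \<open>B\<close>. The factor
  \<open>3 / 4 * sqrt 2\<close> is half of \<lambda>.\<close>

lemma path_solution_turned:
  assumes "B \<le> 2 ^ (j + 1)"
  shows "path_solution B j \<le> 3 / 4 * sqrt 2 * path_solution B (j + 1)"
proof -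
  define x where "x = sqrt 2 ^ j"
  have x: "x > 0" "x * x = 2 ^ j"
    by (simp_all add: x_def flip: power_mult_distrib)
  have *: "sqrt 2 ^ (j + 1) = sqrt 2 * x"
    by (simp_all add: x_def)
  have "B / x \<le> 2 * x"
    using assms x by (simp add: field_simps)
  moreover have "3 / 4 * sqrt 2 * path_solution B (j + 1) = 3 / 2 * x + 3 / 4 * (B / x)"
    using x unfolding path_solution_def * by (simp add: field_simps)
  ultimately show ?thesis
    by (simp add: path_solution_def x_def[symmetric])
qed

lemma path_solution_ratio:
  assumes "B \<ge> 0"
  shows "path_solution B 1 / path_solution B 0 = (B + 2) / (sqrt 2 * (B + 1))"
  using assms by (simp add: path_solution_def field_simps)

text \<open>Read backwards from \<open>m + 1\<close>, the solution with \<open>B = -1\<close> is a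
  multiple of the one with \<open>B = -M\<close>; the value is the formula of
  \<open>path_solution_ratio\<close> at \<open>B = -M\<close>.\<close>

lemma pendant_ratio:
  fixes m :: nat
  defines "M \<equiv> 2 ^ (m + 1) :: real"
  shows "path_solution (-1) m / path_solution (-1) (m + 1) = (M - 2) / (sqrt 2 * (M - 1))"
proof -
  define x where "x = sqrt 2 ^ m"
  have x: "x > 0" "M = 2 * (x * x)"
    by (simp_all add: x_def M_def flip: power_mult_distrib)
  have *: "sqrt 2 ^ (m + 1) = sqrt 2 * x"
    by (simp_all add: x_def)
  have "M > 1"
    unfolding M_def by (rule one_less_power) auto
  have p: "path_solution (-1) m = (M - 2) / (2 * x)"
    using x(1) unfolding path_solution_def x(2) x_def[symmetric] by (simp add: field_simps)
  have p': "path_solution (-1) (m + 1) = (M - 1) / (sqrt 2 * x)"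
    using x(1) unfolding path_solution_def * x(2) by (simp add: field_simps)
  show ?thesis
    using x(1) \<open>M > 1\<close> unfolding p p' by (simp add: field_simps)
qed

text \<open>Past its minimum, each of the two solutions contributes at most $\lambda/2$ at the vertex where
  they are glued together.\<close>

lemma glued_path_solutions:
  assumes "B > 0" "B' > 0" "B \<le> 2 ^ J" "B' \<le> 2 ^ J'" "J > 0" "J' > 0" "J + J' \<le> L"
  shows "\<exists>W. (\<forall>j. W j > 0) \<and>
    W 1 / W 0 = path_solution B 1 / path_solution B 0 \<and>
    W (L - 1) / W L = path_solution B' 1 / path_solution B' 0 \<and>
    (\<forall>j. 0 < j \<and> j < L \<longrightarrow> W (j - 1) + W (j + 1) \<le> 3 / 2 * sqrt 2 * W j)"
proof -
  \<comment> \<open>The gluing point lies exactly \<open>J'\<close> steps from the right end and,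
    since \<open>J + J'\<close> \<le> \<open>L\<close>, at least \<open>J\<close> steps from the
    left end.\<close>
  define N where "N = L - J'"
  have N: "J \<le> N" "N < L" "L - N = J'" "0 < N"
    using assms by (auto simp: N_def)
  let ?f = "path_solution B" and ?g = "path_solution B'"
  have pos: "?f j > 0" "?g j > 0" for j
    using assms by (auto intro: path_solution_pos)
  \<comment> \<open>Both pieces are scaled to the value 1 at \<open>N\<close>, which leaves the end
    quotients unchanged. For \<open>j > L\<close> truncated subtraction gives
    \<open>L - j = 0\<close>, so \<open>W\<close> is positive everywhere.\<close>
  define W where "W j = (if j \<le> N then ?f j / ?f N else ?g (L - j) / ?g J')" for j
  have left: "W j = ?f j / ?f N" if "j \<le> N" for j
    using that by (simp add: W_def)
  have right: "W j = ?g (L - j) / ?g J'" if "N \<le> j" for j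
    using that N pos[of N] pos[of J'] by (cases "j = N") (auto simp: W_def)
  have "W j > 0" for j
    using pos by (simp add: W_def)
  moreover have "W 1 / W 0 = ?f 1 / ?f 0"
    using N pos[of N] by (simp add: left)
  moreover have "W (L - 1) / W L = ?g 1 / ?g 0"
    using N pos[of J'] by (simp add: right)
  moreover have "W (j - 1) + W (j + 1) \<le> 3 / 2 * sqrt 2 * W j" if j: "0 < j" "j < L" for j
  proof -
    consider "j < N" | "j = N" | "j > N"
      by linarith
    then show ?thesis
    proof cases
      case 1
      have "W (j - 1) + W (j + 1) = (?f (j - 1) + ?f (j + 1)) / ?f N"
        using 1 by (simp add: left add_divide_distrib)
      also have "?f (j - 1) + ?f (j + 1) = 3 / 2 * sqrt 2 * ?f j"
        using j path_solution_recurrence[of B "j - 1"] by simp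
      finally show ?thesis
        using 1 by (simp add: left)
    next
      case 2
      have "B \<le> 2 ^ N"
        using assms(3) N(1) by (meson order_trans one_le_numeral power_increasing)
      then have "W (j - 1) \<le> 3 / 4 * sqrt 2"
        using path_solution_turned[of B "N - 1"] N 2 pos[of N] by (simp add: left field_simps)
      moreover have "W (j + 1) \<le> 3 / 4 * sqrt 2"
        using path_solution_turned[of B' "J' - 1"] N 2 assms pos[of J']
        by (simp add: right field_simps N_def)
      moreover have "W j = 1"
        using 2 pos[of N] by (simp add: left)
      ultimately show ?thesis
        by simp
    next
      case 3
      have "W (j - 1) + W (j + 1) = (?g (L - (j + 1)) + ?g (L - (j - 1))) / ?g J'"
        using 3 by (simp add: right add_divide_distrib)
      also have "?g (L - (j + 1)) + ?g (L - (j - 1)) = 3 / 2 * sqrt 2 * ?g (L - j)"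
      proof -
        have "L - (j - 1) = (L - (j + 1)) + 2" "L - j = (L - (j + 1)) + 1"
          using 3 j by auto
        then show ?thesis
          using path_solution_recurrence[of B' "L - (j + 1)"] by simp
      qed
      finally show ?thesis
        using 3 by (simp add: right)
    qed
  qed
  ultimately show ?thesis
    by blast
qed

section \<open>Arcs, neighbourhoods and weights of the open quipu\<close>

lemma path_arcs_map_upt: "path_arcs (map f [0..<n + 1]) = {(f j, f (j + 1)) | j. j < n}"
  by (force simp: path_arcs_def set_zip nth_tl simp del: upt_Suc)

text \<open>A single index from 0 to \<open>k i + 1\<close> runs over the ends and the internal
  vertices alike, so that arcs join consecutive indices and a potential can be written as a function
  of the index.\<close>

definition joint :: "(nat \<Rightarrow> nat) \<Rightarrow> nat \<Rightarrow> nat \<Rightarrow> quipu_vertex" where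
  "joint k i j = (if j = 0 then Node (i - 1) else if j = k i + 1 then Node i else Inner i j)"

definition hang :: "nat \<Rightarrow> nat \<Rightarrow> nat \<Rightarrow> quipu_vertex" where
  "hang i c j = (if j = 0 then Node i else Pendant i c j)"

lemma joining_path_eq: "joining_path k i = map (joint k i) [0..<(k i + 1) + 1]"
proof -
  have "[0..<(k i + 1) + 1] = 0 # [1..<k i + 1] @ [k i + 1]"
    by (simp add: upt_conv_Cons)
  then show ?thesis
    by (simp add: joining_path_def joint_def del: upt_Suc)
qed

lemma pendant_path_eq: "pendant_path m i c = map (hang i c) [0..<m i + 1]"
proof -
  have "[0..<m i + 1] = 0 # [1..<m i + 1]"
    by (simp add: upt_conv_Cons del: upt_Suc)
  then show ?thesis
    by (simp add: pendant_path_def hang_def del: upt_Suc)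
qed

text \<open>The positions differ by one in either direction because each path contributes its arcs
  together with their converses. All neighbourhoods are read off from this rule.\<close>

lemma open_quipu_arc_cases:
  assumes "(u, v) \<in> parcs (open_quipu r m k)"
  obtains
    (joining) i j j' where "1 \<le> i" "i \<le> r" "j \<le> k i + 1" "j' \<le> k i + 1" "j' = j + 1 \<or> j = j' + 1"
      "u = joint k i j" "v = joint k i j'"
  | (pendant) i c j j' where "i \<le> r" "c < num_pendant r i" "j \<le> m i" "j' \<le> m i"
      "j' = j + 1 \<or> j = j' + 1" "u = hang i c j" "v = hang i c j'"
proof -
  obtain xs where xs: "xs \<in> quipu_paths r m k" and uv: "(u, v) \<in> path_arcs xs \<or> (v, u) \<in> path_arcs xs"
    using assms by (auto simp: open_quipu_def)
  from xs consider i where "1 \<le> i" "i \<le> r" "xs = joining_path k i"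
    | i c where "i \<le> r" "c < num_pendant r i" "xs = pendant_path m i c"
    by (auto simp: quipu_paths_def)
  then show ?thesis
  proof cases
    case 1
    then have "path_arcs xs = {(joint k i j, joint k i (j + 1)) | j. j < k i + 1}"
      by (simp only: joining_path_eq path_arcs_map_upt)
    then obtain j where "j < k i + 1"
      "u = joint k i j \<and> v = joint k i (j + 1) \<or> v = joint k i j \<and> u = joint k i (j + 1)"
      using uv by auto
    then show ?thesis
      using joining[of i j "j + 1"] joining[of i "j + 1" j] 1 by auto
  next
    case 2
    then have "path_arcs xs = {(hang i c j, hang i c (j + 1)) | j. j < m i}"
      by (simp only: pendant_path_eq path_arcs_map_upt)
    then obtain j where "j < m i"
      "u = hang i c j \<and> v = hang i c (j + 1) \<or> v = hang i c j \<and> u = hang i c (j + 1)"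
      using uv by auto
    then show ?thesis
      using pendant[of i c j "j + 1"] pendant[of i c "j + 1" j] 2 by auto
  qed
qed

lemma open_quipu_vertex_cases:
  assumes "u \<in> pverts (open_quipu r m k)"
  obtains (Node) i where "i \<le> r" "u = Node i"
  | (Inner) i l where "1 \<le> i" "i \<le> r" "1 \<le> l" "l \<le> k i" "u = Inner i l"
  | (Pendant) i c l where "i \<le> r" "1 \<le> l" "l \<le> m i" "u = Pendant i c l"
  using assms
  by (fastforce simp: open_quipu_def quipu_paths_def joining_path_def pendant_path_def simp del: upt_Suc)

text \<open>\<open>W i\<close> and \<open>P i\<close> are potentials along the \<open>i\<close>-th joining path and along the pendant paths at
  $v_i$; an arc gets the quotient of the potentials of its ends, so opposite arcs get reciprocal
  weights. As each path has its own potential, they need not agree at the \<open>v\<^sub>i\<close>.\<close>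

fun arc_weight :: "(nat \<Rightarrow> nat) \<Rightarrow> (nat \<Rightarrow> nat \<Rightarrow> real) \<Rightarrow> (nat \<Rightarrow> nat \<Rightarrow> real)
    \<Rightarrow> quipu_vertex \<Rightarrow> quipu_vertex \<Rightarrow> real" where
  "arc_weight k W P (Node n) (Inner i l) = W i l / W i (if n = i then k i + 1 else 0)"
| "arc_weight k W P (Inner i l) (Node n) = W i (if n = i then k i + 1 else 0) / W i l"
| "arc_weight k W P (Inner i l) (Inner _ l') = W i l' / W i l"
| "arc_weight k W P (Node _) (Pendant i _ l) = P i l / P i 0"
| "arc_weight k W P (Pendant i _ l) (Node _) = P i 0 / P i l"
| "arc_weight k W P (Pendant i _ l) (Pendant _ _ l') = P i l' / P i l"
| "arc_weight k W P _ _ = 1"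

text \<open>If \<open>k i\<close> were 0, the path would be a single edge between two nodes, to
  which \<open>arc_weight\<close> gives the default 1. Since \<open>1\<close> \<le>
  \<open>i\<close>, the two ends have different node indices, and the test \<open>n = i\<close>
  selects the correct end.\<close>

lemma arc_weight_joint:
  assumes "1 \<le> i" "1 \<le> k i" "j' = j + 1 \<or> j = j' + 1" "j \<le> k i + 1" "j' \<le> k i + 1"
  shows "arc_weight k W P (joint k i j) (joint k i j') = W i j' / W i j"
  using assms by (auto simp: joint_def)

lemma arc_weight_hang:
  assumes "j' = j + 1 \<or> j = j' + 1"
  shows "arc_weight k W P (hang i c j) (hang i c j') = P i j' / P i j"
  using assms by (auto simp: hang_def)

text \<open>Here and in the next two lemmas an inclusion suffices: the weights towards the listed
  vertices are nonnegative, so enlarging the index set can only increase a sum that is bounded from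
  above.\<close>

lemma open_quipu_Node_neighbours:
  assumes "\<And>i. 1 \<le> i \<Longrightarrow> i \<le> r \<Longrightarrow> 1 \<le> k i"
  shows "{v. (Node n, v) \<in> parcs (open_quipu r m k)} \<subseteq>
    (\<lambda>c. Pendant n c 1) ` {..<num_pendant r n} \<union>
    (if 1 \<le> n then {Inner n (k n)} else {}) \<union> (if n < r then {Inner (n + 1) 1} else {})"
proof
  fix v assume "v \<in> {v. (Node n, v) \<in> parcs (open_quipu r m k)}"
  then have "(Node n, v) \<in> parcs (open_quipu r m k)"
    by simp
  then show "v \<in> (\<lambda>c. Pendant n c 1) ` {..<num_pendant r n} \<union>
    (if 1 \<le> n then {Inner n (k n)} else {}) \<union> (if n < r then {Inner (n + 1) 1} else {})"
  proof (cases rule: open_quipu_arc_cases)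
    case (joining i j j')
    with assms[of i] show ?thesis
      by (auto simp: joint_def split: if_splits)
  next
    case (pendant i c j j')
    then show ?thesis
      by (auto simp: hang_def split: if_splits)
  qed
qed

lemma open_quipu_Inner_neighbours:
  assumes "1 \<le> l" "l \<le> k i"
  shows "{v. (Inner i l, v) \<in> parcs (open_quipu r m k)} \<subseteq> {joint k i (l - 1), joint k i (l + 1)}"
proof
  fix v assume "v \<in> {v. (Inner i l, v) \<in> parcs (open_quipu r m k)}"
  then have "(Inner i l, v) \<in> parcs (open_quipu r m k)"
    by simp
  then show "v \<in> {joint k i (l - 1), joint k i (l + 1)}"
  proof (cases rule: open_quipu_arc_cases)
    case (joining i' j j')
    then have "i' = i" "j = l"
      by (auto simp: joint_def split: if_splits)
    then show ?thesis
      using joining by auto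
  next
    case (pendant i c j j')
    then show ?thesis
      by (auto simp: hang_def split: if_splits)
  qed
qed

lemma open_quipu_Pendant_neighbours:
  assumes "1 \<le> l"
  shows "{v. (Pendant i c l, v) \<in> parcs (open_quipu r m k)} \<subseteq>
    insert (hang i c (l - 1)) (if l < m i then {hang i c (l + 1)} else {})"
proof
  fix v assume "v \<in> {v. (Pendant i c l, v) \<in> parcs (open_quipu r m k)}"
  then have "(Pendant i c l, v) \<in> parcs (open_quipu r m k)"
    by simp
  then show "v \<in> insert (hang i c (l - 1)) (if l < m i then {hang i c (l + 1)} else {})"
  proof (cases rule: open_quipu_arc_cases)
    case (joining i' j j')
    then show ?thesis
      by (auto simp: joint_def split: if_splits)
  next
    case (pendant i' c' j j')
    then have eq: "i' = i" "c' = c" "j = l"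
      by (auto simp: hang_def split: if_splits)
    then have "j' = l - 1 \<or> j' = l + 1 \<and> l < m i"
      using pendant by auto
    then show ?thesis
      using pendant eq by auto
  qed
qed

section \<open>Balance of the weights at the nodes\<close>

text \<open>\<open>turning r m i\<close> is the parameter \<open>B\<close> for which the balance condition at $v_i$ holds with
  equality, and \<open>reach r m i\<close> is a distance from $v_i$ at which the solution has passed its
  minimum.\<close>

definition turning :: "nat \<Rightarrow> (nat \<Rightarrow> nat) \<Rightarrow> nat \<Rightarrow> real" where
  "turning r m i = (if i = 0 \<or> i = r then (2 ^ (m i + 1) - 3) / 2 else 2 * 2 ^ (m i + 1) - 3)"

definition reach :: "nat \<Rightarrow> (nat \<Rightarrow> nat) \<Rightarrow> nat \<Rightarrow> nat" where
  "reach r m i = (if i = 0 \<or> i = r then m i else m i + 2)"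

text \<open>The left side is \<open>2 ^ m i - 3/2\<close> at the two end nodes and
  \<open>4 * 2 ^ m i - 3\<close> elsewhere, whence the exponents \<open>m i\<close> and
  \<open>m i + 2\<close>.\<close>

lemma turning_le: "turning r m i \<le> 2 ^ reach r m i"
  by (simp add: turning_def reach_def power_add)

lemma turning_pos:
  assumes "1 \<le> m i" "i = 0 \<or> i = r \<Longrightarrow> 2 \<le> m i"
  shows "turning r m i > 0"
proof -
  have "(2::real) ^ 1 \<le> 2 ^ m i"
    using assms(1) by (intro power_increasing) auto
  moreover have "(2::real) ^ 2 \<le> 2 ^ m i" if "i = 0 \<or> i = r"
    using assms(2)[OF that] by (intro power_increasing) auto
  ultimately show ?thesis
    by (auto simp: turning_def)
qed

text \<open>In terms of \<open>D = M - 1\<close> the two pendant paths contribute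
  \<open>2 * (D - 1) / (sqrt 2 * D)\<close> and the joining path
  \<open>(D + 2) / (sqrt 2 * D)\<close>. The constants cancel and \<open>3 / sqrt 2\<close>
  remains.\<close>

lemma end_node_balance:
  assumes "i = 0 \<or> i = r" "turning r m i > 0"
  shows "2 * (path_solution (-1) (m i) / path_solution (-1) (m i + 1)) +
    path_solution (turning r m i) 1 / path_solution (turning r m i) 0 = 3 / 2 * sqrt 2"
proof -
  define M :: real where "M = 2 ^ (m i + 1)"
  have B: "turning r m i = (M - 3) / 2"
    using assms(1) by (simp add: turning_def M_def)
  have "M > 1"
    unfolding M_def by (rule one_less_power) auto
  then obtain D where D: "M = D + 1" "D > 0"
    by (metis diff_add_cancel diff_gt_0_iff_gt)
  have eqs: "(D + 1 - 3) / 2 + 2 = (D + 2) / 2" "(D + 1 - 3) / 2 + 1 = D / 2" "D + 1 - 1 = D"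
    by (simp_all add: field_simps)
  show ?thesis
    unfolding pendant_ratio path_solution_ratio[OF less_imp_le[OF assms(2)]]
    unfolding B M_def[symmetric] D(1) eqs
    using D(2) by (simp add: field_simps)
qed

text \<open>Now the pendant path contributes \<open>(D - 1) / (sqrt 2 * D)\<close> and the two
  joining paths together \<open>(2 * D + 1) / (sqrt 2 * D)\<close>, again with sum
  \<open>3 / sqrt 2\<close>.\<close>

lemma inner_node_balance:
  assumes "i \<noteq> 0" "i \<noteq> r" "turning r m i > 0"
  shows "path_solution (-1) (m i) / path_solution (-1) (m i + 1) +
    2 * (path_solution (turning r m i) 1 / path_solution (turning r m i) 0) = 3 / 2 * sqrt 2"
proof -
  define M :: real where "M = 2 ^ (m i + 1)"
  have B: "turning r m i = 2 * M - 3"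
    using assms(1,2) by (simp add: turning_def M_def)
  have "M > 1"
    unfolding M_def by (rule one_less_power) auto
  then obtain D where D: "M = D + 1" "D > 0"
    by (metis diff_add_cancel diff_gt_0_iff_gt)
  have eqs: "2 * (D + 1) - 3 + 2 = 2 * D + 1" "2 * (D + 1) - 3 + 1 = 2 * D" "D + 1 - 1 = D"
    by simp_all
  show ?thesis
    unfolding pendant_ratio path_solution_ratio[OF less_imp_le[OF assms(3)]]
    unfolding B M_def[symmetric] D(1) eqs
    using D(2) by (simp add: field_simps)
qed

section \<open>The non-strict eigenvalue bound for open quipus\<close>

lemma open_quipu_eigenvalue_le:
  fixes r :: nat and m k :: "nat \<Rightarrow> nat"
  assumes r: "r \<ge> 1"
    and m: "\<And>i. i \<le> r \<Longrightarrow> m i \<ge> 1" "m 0 \<ge> 2" "m r \<ge> 2"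
    and k: "\<And>i. 1 \<le> i \<Longrightarrow> i \<le> r \<Longrightarrow> reach r m (i - 1) + reach r m i \<le> k i + 1"
    and ev: "eigenvalue (adjacency_matrix (open_quipu r m k)) c"
  shows "c \<le> 3 / 2 * sqrt 2"
proof -
  let ?B = "turning r m" and ?lam = "3 / 2 * sqrt 2"
  let ?rho = "\<lambda>i. path_solution (?B i) 1 / path_solution (?B i) 0"
  have B: "?B i > 0" if "i \<le> r" for i
    using m that by (intro turning_pos) auto
  have reach: "reach r m i > 0" if "i \<le> r" for i
    using m(1)[OF that] by (auto simp: reach_def)
  have k1: "1 \<le> k i" if "1 \<le> i" "i \<le> r" for i
  proof -
    have "reach r m (i - 1) > 0" "reach r m i > 0"
      using that by (auto intro: reach)
    then show ?thesis
      using k[OF that] by linarith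
  qed
  \<comment> \<open>The joining path has \<open>L = k i + 1\<close> edges; the form
    \<open>k i + 1 - 1\<close> is kept so that the statement is literally an instance of
    \<open>glued_path_solutions\<close>.\<close>
  have "\<forall>i\<in>{1..r}. \<exists>W. (\<forall>j. W j > 0) \<and> W 1 / W 0 = ?rho (i - 1) \<and>
      W (k i + 1 - 1) / W (k i + 1) = ?rho i \<and>
      (\<forall>j. 0 < j \<and> j < k i + 1 \<longrightarrow> W (j - 1) + W (j + 1) \<le> ?lam * W j)"
  proof
    fix i assume "i \<in> {1..r}"
    then have i: "1 \<le> i" "i \<le> r" "i - 1 \<le> r"
      by auto
    show "\<exists>W. (\<forall>j. W j > 0) \<and> W 1 / W 0 = ?rho (i - 1) \<and>
        W (k i + 1 - 1) / W (k i + 1) = ?rho i \<and>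
        (\<forall>j. 0 < j \<and> j < k i + 1 \<longrightarrow> W (j - 1) + W (j + 1) \<le> ?lam * W j)"
      by (rule glued_path_solutions[OF B[OF i(3)] B[OF i(2)] turning_le turning_le
            reach[OF i(3)] reach[OF i(2)] k[OF i(1,2)]])
  qed
  from bchoice[OF this] obtain W where W: "\<forall>i\<in>{1..r}. (\<forall>j. W i j > 0) \<and> W i 1 / W i 0 = ?rho (i - 1) \<and>
      W i (k i + 1 - 1) / W i (k i + 1) = ?rho i \<and>
      (\<forall>j. 0 < j \<and> j < k i + 1 \<longrightarrow> W i (j - 1) + W i (j + 1) \<le> ?lam * W i j)"
    by blast
  have W_pos: "W i j > 0" if "1 \<le> i" "i \<le> r" for i j
    using W that by simp
  have W_left: "W i 1 / W i 0 = ?rho (i - 1)" if "1 \<le> i" "i \<le> r" for i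
    using W that by simp
  have W_right: "W i (k i) / W i (k i + 1) = ?rho i" if "1 \<le> i" "i \<le> r" for i
    using W that by simp
  have W_inner: "W i (j - 1) + W i (j + 1) \<le> ?lam * W i j"
    if "1 \<le> i" "i \<le> r" "1 \<le> j" "j \<le> k i" for i j
    using W that by simp
  \<comment> \<open>The potential is reversed so that its zero falls at \<open>l = m i + 1\<close>,
    one step beyond the last vertex of the pendant path.\<close>
  define P where "P i l = path_solution (-1) (m i + 1 - l)" for i l
  have P_pos: "P i l > 0" if "l \<le> m i" for i l
    using that by (simp add: P_def path_solution_neg_one_pos)
  define q where "q = arc_weight k W P"
  have q_joint: "q (joint k i j) (joint k i j') = W i j' / W i j"
    if "1 \<le> i" "i \<le> r" "j' = j + 1 \<or> j = j' + 1" "j \<le> k i + 1" "j' \<le> k i + 1" for i j j'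
    unfolding q_def using that k1 by (intro arc_weight_joint) auto
  have q_hang: "q (hang i c j) (hang i c j') = P i j' / P i j"
    if "j' = j + 1 \<or> j = j' + 1" for i c j j'
    unfolding q_def using that by (rule arc_weight_hang)
  show ?thesis
  proof (rule eigenvalue_le_arc_weights[OF pair_graph_open_quipu ev, of q])
    fix u v assume "(u, v) \<in> parcs (open_quipu r m k)"
    then have "q u v > 0 \<and> q u v * q v u = 1"
    proof (cases rule: open_quipu_arc_cases)
      case (joining i j j')
      then have "q u v = W i j' / W i j" "q v u = W i j / W i j'"
        using q_joint[of i j' j] q_joint[of i j j'] by auto
      then show ?thesis
        using W_pos[of i j] W_pos[of i j'] joining by simp
    next
      case (pendant i c j j')
      then have "q u v = P i j' / P i j" "q v u = P i j / P i j'"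
        using q_hang[of j' j i c] q_hang[of j j' i c] by auto
      then show ?thesis
        using P_pos[of j i] P_pos[of j' i] pendant by simp
    qed
    then show "q u v > 0" "q u v * q v u = 1"
      by auto
  next
    fix u assume "u \<in> pverts (open_quipu r m k)"
    then show "(\<Sum>v | (u, v) \<in> parcs (open_quipu r m k). q u v) \<le> ?lam"
    proof (cases rule: open_quipu_vertex_cases)
      case (Node i)
      let ?S = "(\<lambda>c. Pendant i c 1) ` {..<num_pendant r i}"
      let ?L = "if 1 \<le> i then {Inner i (k i)} else {}"
      let ?R = "if i < r then {Inner (i + 1) 1} else {}"
      have pend: "q u (Pendant i c 1) = P i 1 / P i 0" for c
        by (simp add: q_def Node)
      have left: "q u (Inner i (k i)) = ?rho i" if "1 \<le> i"
        using W_right[OF that] Node by (simp add: q_def)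
      have right: "q u (Inner (i + 1) 1) = ?rho i" if "i < r"
        using W_left[of "i + 1"] Node that by (simp add: q_def)
      have "m i \<ge> 1"
        using m Node by auto
      have nonneg: "P i 1 / P i 0 \<ge> 0" "?rho i \<ge> 0"
        using P_pos[of 0 i] P_pos[of 1 i] \<open>m i \<ge> 1\<close> path_solution_pos[of "?B i"] B[of i] Node
        by (auto intro!: divide_nonneg_nonneg less_imp_le)
      have "(\<Sum>v | (u, v) \<in> parcs (open_quipu r m k). q u v) \<le> sum (q u) (?S \<union> ?L \<union> ?R)"
        using open_quipu_Node_neighbours[of r k i m] k1 nonneg Node left right pend
        by (intro sum_mono2) (auto split: if_splits)
      also have "\<dots> = sum (q u) ?S + sum (q u) ?L + sum (q u) ?R"
        by (subst sum.union_disjoint, simp, simp, force, subst sum.union_disjoint) auto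
      also have "sum (q u) ?S = num_pendant r i * (P i 1 / P i 0)"
        by (subst sum.reindex) (auto simp: inj_on_def pend simp del: One_nat_def)
      also have "sum (q u) ?L = (if 1 \<le> i then ?rho i else 0)"
        using left by simp
      also have "sum (q u) ?R = (if i < r then ?rho i else 0)"
        using right by simp
      \<comment> \<open>Because \<open>r\<close> is positive, 0 and \<open>r\<close> are distinct:
        an end node has two pendant paths and one joining path, any other node one pendant path and
        two joining paths. These are the two balance lemmas.\<close>
      also have "num_pendant r i * (P i 1 / P i 0) + (if 1 \<le> i then ?rho i else 0) +
          (if i < r then ?rho i else 0) = ?lam"
        using end_node_balance[of i r m] inner_node_balance[of i r m] B[of i] r Node(1)
        by (auto simp: P_def num_pendant_def)
      finally show ?thesis .
    next
      case (Inner i l)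
      have ne: "joint k i (l - 1) \<noteq> joint k i (l + 1)"
        using Inner by (auto simp: joint_def)
      have u: "u = joint k i l"
        using Inner by (auto simp: joint_def)
      have q: "q u (joint k i (l - 1)) = W i (l - 1) / W i l" "q u (joint k i (l + 1)) = W i (l + 1) / W i l"
        using Inner q_joint[of i "l - 1" l] q_joint[of i "l + 1" l] by (auto simp: u)
      have "(\<Sum>v | (u, v) \<in> parcs (open_quipu r m k). q u v) \<le> sum (q u) {joint k i (l - 1), joint k i (l + 1)}"
        using open_quipu_Inner_neighbours[of l k i r m] Inner q W_pos[of i]
        by (intro sum_mono2) (auto simp: less_imp_le)
      also have "\<dots> = (W i (l - 1) + W i (l + 1)) / W i l"
        using ne q by (simp add: add_divide_distrib)
      also have "\<dots> \<le> ?lam"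
        using W_inner[of i l] W_pos[of i l] Inner by (simp add: divide_le_eq)
      finally show ?thesis .
    next
      case (Pendant i c l)
      let ?T = "if l < m i then {hang i c (l + 1)} else {}"
      have ne: "hang i c (l - 1) \<noteq> hang i c (l + 1)"
        using Pendant by (auto simp: hang_def)
      have u: "u = hang i c l"
        using Pendant by (auto simp: hang_def)
      have q: "q u (hang i c (l - 1)) = P i (l - 1) / P i l" "q u (hang i c (l + 1)) = P i (l + 1) / P i l"
        using Pendant q_hang[of "l - 1" l i c] q_hang[of "l + 1" l i c] by (auto simp: u)
      have "P i l > 0" "P i (l - 1) > 0" "l < m i \<Longrightarrow> P i (l + 1) > 0"
        using P_pos[of l i] P_pos[of "l - 1" i] P_pos[of "l + 1" i] Pendant by auto
      then have "(\<Sum>v | (u, v) \<in> parcs (open_quipu r m k). q u v) \<le> sum (q u) (insert (hang i c (l - 1)) ?T)"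
        using open_quipu_Pendant_neighbours[of l i c r m k] Pendant q
        by (intro sum_mono2) (auto simp: less_imp_le split: if_splits)
      also have "\<dots> = P i (l - 1) / P i l + (if l < m i then P i (l + 1) / P i l else 0)"
        using ne q by simp
      \<comment> \<open>At the last vertex, \<open>l = m i\<close>, the added term is
        \<open>path_solution (-1) 0 = 0\<close>, so the leaf obeys the same recurrence as the other
        pendant vertices.\<close>
      also have "\<dots> = (P i (l - 1) + P i (l + 1)) / P i l"
        using Pendant by (cases "l = m i") (auto simp: P_def path_solution_def add_divide_distrib)
      also have "P i (l - 1) + P i (l + 1) = ?lam * P i l"
      proof -
        have "m i + 1 - (l - 1) = (m i - l) + 2" "m i + 1 - l = (m i - l) + 1"
          "m i + 1 - (l + 1) = m i - l"
          using Pendant by auto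
        then show ?thesis
          using path_solution_recurrence[of "-1" "m i - l"] by (simp only: P_def add.commute)
      qed
      finally show ?thesis
        using \<open>P i l > 0\<close> by simp
    qed
  qed
qed

section \<open>The spectral radius and strictness of the bound\<close>

theorem theorem4p1:
  fixes r :: nat and m k :: "nat \<Rightarrow> nat"
  assumes "r \<ge> 1"
    and "\<forall>i \<in> {0..r}. m i \<ge> 1"
    and "m 0 \<ge> 2" and "m r \<ge> 2"
    and "\<forall>i \<in> {2..r - 1}. k i \<ge> m (i - 1) + m i + 3"
    and "\<forall>j \<in> {1, r}. k j \<ge> m (j - 1) + m j + 1"
  shows "graph_spectral_radius (open_quipu r m k) < 3 / 2 * sqrt 2"
proof -
  let ?G = "open_quipu r m k" and ?c = "graph_spectral_radius (open_quipu r m k)"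
  have "pendant_path m 0 0 \<in> quipu_paths r m k"
    unfolding quipu_paths_def
    by (intro UnI2 CollectI exI[of _ 0] conjI) (simp_all add: num_pendant_def)
  moreover have "Node 0 \<in> set (pendant_path m 0 0)"
    by (simp add: pendant_path_def)
  ultimately have "pverts ?G \<noteq> {}"
    by (force simp: open_quipu_def)
  then have ev: "eigenvalue (adjacency_matrix ?G) ?c"
    by (rule graph_spectral_radius_eigenvalue[OF pair_graph_open_quipu])
  have "reach r m (i - 1) + reach r m i \<le> k i + 1" if "1 \<le> i" "i \<le> r" for i
  proof -
    \<comment> \<open>A middle joining path has two interior nodes as ends, which add 4 to the
      reaches; against the \<open>k i + 1\<close> edges this leaves the 3 of the hypothesis. The
      first and the last joining path have at most one interior end, which adds at most 2 and leaves
      at most 1.\<close>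
    have "i = 1 \<or> i = r \<or> i \<in> {2..r - 1}"
      using that by auto
    then show ?thesis
      using assms(5,6) that by (fastforce simp: reach_def)
  qed
  then have "?c \<le> 3 / 2 * sqrt 2"
    using assms ev by (intro open_quipu_eigenvalue_le) auto
  moreover have "?c \<noteq> 3 / 2 * sqrt 2"
  proof
    assume "?c = 3 / 2 * sqrt 2"
    moreover have "(3 / 2 * sqrt 2)\<^sup>2 = 9 / 2"
      by (simp add: power_mult_distrib power_divide)
    ultimately have sq: "?c\<^sup>2 = 9 / 2"
      by (simp only:)
    have "?c\<^sup>2 \<in> \<rat>"
      unfolding sq by simp
    then have "?c\<^sup>2 \<in> \<int>"
      by (rule adjacency_eigenvalue_square_Ints[OF ev])
    then obtain n :: int where "9 / 2 = real_of_int n"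
      unfolding sq by (elim Ints_cases)
    then have "real_of_int (2 * n) = real_of_int 9"
      by simp
    then have "2 * n = 9"
      by (simp only: of_int_eq_iff)
    then show False
      by presburger
  qed
  ultimately show ?thesis
    by simp
qed

end
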